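(* For any pair of integers $s,h\ge 2$ there exists $n_0=n_0(h,s)$ such that for all $n\ge n_0$, $$La_{rp}(n,\{Y_{h,s},Y'_{h,s}\})=\Sigma(n,h)=\sum_{i=1}^{h}\binom{n}{\lfloor (n-h)/2\rfloor+i}.$$
   Context: $Y_{h,s}$ denotes the poset on $h+s$ elements $x_1,\dots,x_h,y_1,\dots,y_s$ with $x_1<x_2<\dots<x_h<y_j$ for every $j$ (and the $y_j$ pairwise incomparable); it is graded with rank $\rho(x_i)=i$ and $\rho(y_j)=h+1$. $Y'_{h,s}$ denotes its dual poset (same elements, order reversed), graded correspondingly ($y_j$ of rank $0$, $x_i$ of rank $h+1-i$). For a family $\mathcal F$ of subsets of $[n]=\{1,\dots,n\}$, a subfamily $\mathcal G\subseteq\mathcal F$ is a rank-preserving copy of a graded poset $P$ with rank function $\rho$ if there is a bijection $\phi:P\to\mathcal G$ such that $\phi(x)\subseteq\phi(y)$ whenever $x\le_P y$, and $|\phi(x)|=|\phi(y)|$ whenever $\rho(x)=\rho(y)$. $La_{rp}(n,\{Y_{h,s},Y'_{h,s}\})$ denotes the maximum size of a family $\mathcal F\subseteq 2^{[n]}$ containing neither a rank-preserving copy of $Y_{h,s}$ nor a rank-preserving copy of $Y'_{h,s}$. $\Sigma(n,h)$ is the number of sets in the $h$ middle layers of $2^{[n]}$. *)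

theory Defs
  imports Complex_Main
begin

record 'a graded_poset =
  elems :: "'a set"
  le :: "('a \<times> 'a) set"
  rank :: "'a \<Rightarrow> nat"

datatype Y_elem = X nat | Y nat

definition Y_poset :: "nat \<Rightarrow> nat \<Rightarrow> Y_elem graded_poset" where
  "Y_poset h s =
    \<lparr>elems = X ` {1..h} \<union> Y ` {1..s},
     le = {(X i, X j) |i j. 1 \<le> i \<and> i \<le> j \<and> j \<le> h}
          \<union> X ` {1..h} \<times> Y ` {1..s}
          \<union> Id_on (Y ` {1..s}),
     rank = (\<lambda>p. case p of X i \<Rightarrow> i | Y j \<Rightarrow> h + 1)\<rparr>"

definition Y_poset_dual :: "nat \<Rightarrow> nat \<Rightarrow> Y_elem graded_poset" where
  "Y_poset_dual h s =
    \<lparr>elems = elems (Y_poset h s),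
     le = (le (Y_poset h s))\<inverse>,
     rank = (\<lambda>p. case p of X i \<Rightarrow> h + 1 - i | Y j \<Rightarrow> 0)\<rparr>"

lemma partial_order_Y_poset:
  "partial_order_on (elems (Y_poset h s)) (le (Y_poset h s))"
  by (auto simp: Y_poset_def partial_order_on_def preorder_on_def refl_on_def
      intro!: transI antisymI)

lemma partial_order_Y_poset_dual:
  "partial_order_on (elems (Y_poset_dual h s)) (le (Y_poset_dual h s))"
  using partial_order_Y_poset[of h s] by (simp add: Y_poset_dual_def)

text \<open>A copy is weak: \<open>\<phi>\<close> need not reflect the order.\<close>

definition rank_preserving_copy :: "'a graded_poset \<Rightarrow> nat set set \<Rightarrow> bool" where
  "rank_preserving_copy P \<G> \<longleftrightarrow>
    (\<exists>\<phi>. bij_betw \<phi> (elems P) \<G> \<and>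
      (\<forall>x\<in>elems P. \<forall>y\<in>elems P. (x, y) \<in> le P \<longrightarrow> \<phi> x \<subseteq> \<phi> y) \<and>
      (\<forall>x\<in>elems P. \<forall>y\<in>elems P. rank P x = rank P y \<longrightarrow> card (\<phi> x) = card (\<phi> y)))"

definition rp_free :: "'a graded_poset set \<Rightarrow> nat set set \<Rightarrow> bool" where
  "rp_free \<P> \<F> \<longleftrightarrow> (\<forall>P\<in>\<P>. \<forall>\<G>\<subseteq>\<F>. \<not> rank_preserving_copy P \<G>)"

definition La_rp :: "nat \<Rightarrow> 'a graded_poset set \<Rightarrow> nat" where
  "La_rp n \<P> = Max {card \<F> |\<F>. \<F> \<subseteq> Pow {1..n} \<and> rp_free \<P> \<F>}"

text \<open>
  The \<open>h\<close> middle layers are those of size \<open>k\<close> with \<open>(n - h) / 2 < k \<le> (n + h) / 2\<close>. If \<open>n - h\<close>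
  is even there are two symmetric choices of the same total size, and this is the upper one.
\<close>

definition middle_layers :: "nat \<Rightarrow> nat \<Rightarrow> nat set set" where
  "middle_layers n h = {A. A \<subseteq> {1..n} \<and> n < 2 * card A + h \<and> 2 * card A \<le> n + h}"

definition Sigma_layers :: "nat \<Rightarrow> nat \<Rightarrow> nat" where
  "Sigma_layers n h = card (middle_layers n h)"

end

theory Submission imports Defs "HOL-Combinatorics.Multiset_Permutations" begin

text \<open>
  Call a member of the family \<^emph>\<open>upper\<close> (\<^emph>\<open>lower\<close>) if it is the top (bottom) of an \<open>h\<close>-chain of the
  family; freeness means that it has fewer than \<open>s\<close> supersets (subsets) in the family on each
  level. If a maximal chain contains more than \<open>h\<close> members, then some \<open>h - 1\<close> consecutive ones
  start at a lower and end at an upper member. Fixing such a window, a random continuation of it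
  on both sides meets the family with probability \<open>O(1/n)\<close> only, so the typical chain through a
  window has just \<open>h - 1\<close> members, and this compensates for the exceptional longer chains. Hence
  the LYM sum is at most \<open>h\<close>.

  The \<open>O(1/n)\<close> estimate fails near the bottom and the top of the cube (where, for instance, the
  empty set and the whole set can push the LYM sum to \<open>h + 1\<close>). Members within a constant distance
  \<open>r\<close> of these are therefore counted with the weight of the outermost middle layer only. Their
  contribution to a single chain is then at most \<open>1/2\<close>, and the bound on the weighted sum still
  implies the bound on the size of the family.
\<close>

section \<open>Maximal chains as permutations\<close>

text \<open>The index needs no bound because \<open>take\<close> saturates at the whole list. For a
  distinct list these sets form the maximal chain from the empty set to
  \<open>set xs\<close>.\<close>

definition prefix_sets :: "'a list \<Rightarrow> 'a set set" where
  "prefix_sets xs = range (\<lambda>k. set (take k xs))"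

lemma prefix_sets_linear:
  assumes "A \<in> prefix_sets xs" "B \<in> prefix_sets xs"
  shows "A \<subseteq> B \<or> B \<subseteq> A"
proof -
  obtain i j where "A = set (take i xs)" "B = set (take j xs)"
    using assms by (auto simp: prefix_sets_def)
  then show ?thesis
    using set_take_subset_set_take[of i j xs] set_take_subset_set_take[of j i xs] nat_le_linear[of i j]
    by blast
qed

lemma prefix_sets_subset: "A \<in> prefix_sets xs \<Longrightarrow> A \<subseteq> set xs"
  unfolding prefix_sets_def using set_take_subset by fastforce

lemma set_in_prefix_sets: "set xs \<in> prefix_sets xs"
  unfolding prefix_sets_def by (metis order_refl rangeI take_all)

lemma empty_in_prefix_sets: "{} \<in> prefix_sets xs"
  unfolding prefix_sets_def by (metis rangeI set_empty take_0)

lemma finite_prefix_sets: "finite (prefix_sets xs)"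
  by (rule finite_subset[of _ "Pow (set xs)"]) (auto dest: prefix_sets_subset)

lemma prefix_sets_append:
  "prefix_sets (u @ w) = prefix_sets u \<union> (\<union>) (set u) ` prefix_sets w"
proof (intro equalityI subsetI)
  fix G assume "G \<in> prefix_sets (u @ w)"
  then obtain k where k: "G = set (take k (u @ w))" by (auto simp: prefix_sets_def)
  show "G \<in> prefix_sets u \<union> (\<union>) (set u) ` prefix_sets w"
  proof (cases "k \<le> length u")
    case True then show ?thesis using k by (auto simp: prefix_sets_def)
  next
    case False then show ?thesis using k by (auto simp: prefix_sets_def)
  qed
next
  fix G assume "G \<in> prefix_sets u \<union> (\<union>) (set u) ` prefix_sets w"
  then show "G \<in> prefix_sets (u @ w)"
  proof
    assume "G \<in> prefix_sets u"
    then obtain k where k: "G = set (take k u)" by (auto simp: prefix_sets_def)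
    then have "G = set (take (min k (length u)) (u @ w))" by (simp add: min_def)
    then show ?thesis unfolding prefix_sets_def by blast
  next
    assume "G \<in> (\<union>) (set u) ` prefix_sets w"
    then obtain k where "G = set u \<union> set (take k w)" by (auto simp: prefix_sets_def)
    then have "G = set (take (length u + k) (u @ w))" by simp
    then show ?thesis unfolding prefix_sets_def by blast
  qed
qed

lemma prefix_sets_append_lower:
  assumes "G \<subseteq> set u"
  shows "G \<in> prefix_sets (u @ w) \<longleftrightarrow> G \<in> prefix_sets u"
  using assms set_in_prefix_sets[of u] by (auto simp: prefix_sets_append Un_absorb2)

lemma prefix_sets_append_upper:
  assumes "set u \<subseteq> G" "set u \<inter> set w = {}"
  shows "G \<in> prefix_sets (u @ w) \<longleftrightarrow> G - set u \<in> prefix_sets w"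
proof
  assume "G \<in> prefix_sets (u @ w)"
  then consider "G \<in> prefix_sets u" | G' where "G' \<in> prefix_sets w" "G = set u \<union> G'"
    by (auto simp: prefix_sets_append)
  then show "G - set u \<in> prefix_sets w"
  proof cases
    case 1
    then have "G - set u = {}" using prefix_sets_subset by blast
    then show ?thesis by (simp only: empty_in_prefix_sets)
  next
    case 2
    then have "G - set u = G'" using assms(2) prefix_sets_subset by fastforce
    with 2 show ?thesis by simp
  qed
next
  assume "G - set u \<in> prefix_sets w"
  moreover have "G = set u \<union> (G - set u)" using assms(1) by blast
  ultimately show "G \<in> prefix_sets (u @ w)" unfolding prefix_sets_append by blast
qed

text \<open>A permutation whose chain passes through \<open>A\<close> is, in exactly one way, an
  ordering of \<open>A\<close> followed by an ordering of \<open>S - A\<close>. The two halves of a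
  random chain through \<open>A\<close> are thus independent.\<close>

lemma sum_permutations_through:
  fixes g :: "'a list \<Rightarrow> 'b::comm_monoid_add"
  assumes "A \<subseteq> S"
  shows "(\<Sum>xs | xs \<in> permutations_of_set S \<and> A \<in> prefix_sets xs. g xs) =
    (\<Sum>u\<in>permutations_of_set A. \<Sum>w\<in>permutations_of_set (S - A). g (u @ w))"
proof -
  let ?P = "permutations_of_set A \<times> permutations_of_set (S - A)"
  have inj: "inj_on (\<lambda>(u, w). u @ w) ?P"
  proof (rule inj_onI, clarify)
    fix u w u' w'
    assume "u \<in> permutations_of_set A" "u' \<in> permutations_of_set A" and e: "u @ w = u' @ w'"
    then have "length u = length u'"
      by (simp add: length_finite_permutations_of_set)
    with e show "u = u' \<and> w = w'" by simp
  qed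
  have img: "(\<lambda>(u, w). u @ w) ` ?P = {xs. xs \<in> permutations_of_set S \<and> A \<in> prefix_sets xs}"
  proof (intro equalityI subsetI)
    fix xs assume "xs \<in> (\<lambda>(u, w). u @ w) ` ?P"
    then obtain u w where uw: "xs = u @ w" "set u = A" "distinct u" "set w = S - A" "distinct w"
      by (auto simp: permutations_of_set_def)
    then have "A \<in> prefix_sets xs"
      using set_in_prefix_sets[of u] by (auto simp: prefix_sets_append)
    with uw assms show "xs \<in> {xs. xs \<in> permutations_of_set S \<and> A \<in> prefix_sets xs}"
      by (auto simp: permutations_of_set_def)
  next
    fix xs assume "xs \<in> {xs. xs \<in> permutations_of_set S \<and> A \<in> prefix_sets xs}"
    then have xs: "set xs = S" "distinct xs" and "A \<in> prefix_sets xs"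
      by (auto simp: permutations_of_set_def)
    then obtain k where k: "A = set (take k xs)" by (auto simp: prefix_sets_def)
    have d: "distinct (take k xs @ drop k xs)" using xs by simp
    have "set (take k xs) \<union> set (drop k xs) = S" using xs by (metis append_take_drop_id set_append)
    with d k have "set (drop k xs) = S - A" unfolding distinct_append by blast
    with d k have "(take k xs, drop k xs) \<in> ?P" by (auto simp: permutations_of_set_def)
    then show "xs \<in> (\<lambda>(u, w). u @ w) ` ?P" by (rule image_eqI[rotated]) simp
  qed
  show ?thesis
    unfolding img[symmetric] sum.reindex[OF inj]
    by (simp add: sum.cartesian_product case_prod_unfold)
qed

lemma card_permutations_through:
  assumes "A \<subseteq> S" "finite S"
  shows "card {xs. xs \<in> permutations_of_set S \<and> A \<in> prefix_sets xs} =
    fact (card A) * fact (card S - card A)"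
  using sum_permutations_through[OF assms(1), of "\<lambda>_. 1 :: nat"] assms
  by (simp add: card_Diff_subset finite_subset)

text \<open>Cut at \<open>B\<close> first and then cut the initial piece at \<open>A\<close>: once
  the chain passes through \<open>B\<close>, whether it meets \<open>A\<close> depends on the
  ordering of \<open>B\<close> alone.\<close>

lemma sum_permutations_through_pair:
  fixes g :: "'a list \<Rightarrow> 'b::comm_monoid_add"
  assumes "A \<subseteq> B" "B \<subseteq> S"
  shows "(\<Sum>xs | xs \<in> permutations_of_set S \<and> A \<in> prefix_sets xs \<and> B \<in> prefix_sets xs. g xs) =
    (\<Sum>u\<in>permutations_of_set A. \<Sum>v\<in>permutations_of_set (B - A).
      \<Sum>w\<in>permutations_of_set (S - B). g (u @ v @ w))"
proof -
  have "(\<Sum>xs | xs \<in> permutations_of_set S \<and> A \<in> prefix_sets xs \<and> B \<in> prefix_sets xs. g xs) =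
    (\<Sum>xs | xs \<in> permutations_of_set S \<and> B \<in> prefix_sets xs.
       if A \<in> prefix_sets xs then g xs else 0)"
    by (subst sum.If_cases) (auto intro!: sum.cong)
  also have "\<dots> = (\<Sum>y\<in>permutations_of_set B. \<Sum>w\<in>permutations_of_set (S - B).
      if A \<in> prefix_sets (y @ w) then g (y @ w) else 0)"
    by (rule sum_permutations_through[OF assms(2)])
  also have "\<dots> = (\<Sum>y\<in>permutations_of_set B.
      if A \<in> prefix_sets y then \<Sum>w\<in>permutations_of_set (S - B). g (y @ w) else 0)"
    using assms(1)
    by (intro sum.cong refl) (auto simp: prefix_sets_append_lower dest!: permutations_of_setD(1))
  also have "\<dots> = (\<Sum>y | y \<in> permutations_of_set B \<and> A \<in> prefix_sets y.
      \<Sum>w\<in>permutations_of_set (S - B). g (y @ w))"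
    by (subst sum.If_cases) (auto intro!: sum.cong)
  also have "\<dots> = (\<Sum>u\<in>permutations_of_set A. \<Sum>v\<in>permutations_of_set (B - A).
      \<Sum>w\<in>permutations_of_set (S - B). g (u @ v @ w))"
    by (subst sum_permutations_through[OF assms(1)]) simp
  finally show ?thesis .
qed

text \<open>Double counting, since \<open>G\<close> lies on
  \<open>fact (card G) * fact (card S - card G)\<close> chains. With \<open>c = 1\<close> the
  average is the LYM sum; a general \<open>c\<close> admits other weights for the far
  members.\<close>

lemma sum_sum_permutations_through:
  fixes c :: "'a set \<Rightarrow> real"
  assumes "finite S" "\<G> \<subseteq> Pow S"
  shows "(\<Sum>xs\<in>permutations_of_set S. \<Sum>G\<in>\<G> \<inter> prefix_sets xs. c G) =
    fact (card S) * (\<Sum>G\<in>\<G>. c G / real (card S choose card G))"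
proof -
  have fG: "finite \<G>" using assms finite_subset by blast
  have "(\<Sum>xs\<in>permutations_of_set S. \<Sum>G\<in>\<G> \<inter> prefix_sets xs. c G) =
    (\<Sum>xs\<in>permutations_of_set S. \<Sum>G\<in>\<G>. if G \<in> prefix_sets xs then c G else 0)"
    by (intro sum.cong refl sum.inter_restrict[OF fG])
  also have "\<dots> = (\<Sum>G\<in>\<G>. \<Sum>xs\<in>permutations_of_set S. if G \<in> prefix_sets xs then c G else 0)"
    by (rule sum.swap)
  also have "\<dots> = (\<Sum>G\<in>\<G>. fact (card S) * (c G / real (card S choose card G)))"
  proof (intro sum.cong refl)
    fix G assume "G \<in> \<G>"
    then have G: "G \<subseteq> S" using assms by auto
    then have le: "card G \<le> card S" using assms by (simp add: card_mono)
    have "(\<Sum>xs\<in>permutations_of_set S. if G \<in> prefix_sets xs then c G else 0) =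
      (\<Sum>xs | xs \<in> permutations_of_set S \<and> G \<in> prefix_sets xs. c G)"
      by (subst sum.If_cases) (simp_all only: Int_def mem_Collect_eq finite_permutations_of_set sum.neutral_const add_0_right)
    also have "\<dots> = real (fact (card G) * fact (card S - card G)) * c G"
      by (simp only: sum_constant card_permutations_through[OF G assms(1)])
    also have "\<dots> = fact (card S) * (c G / real (card S choose card G))"
      using le by (simp add: binomial_fact field_simps)
    finally show "(\<Sum>xs\<in>permutations_of_set S. if G \<in> prefix_sets xs then c G else 0) =
      fact (card S) * (c G / real (card S choose card G))" .
  qed
  finally show ?thesis by (simp add: sum_distrib_left)
qed

section \<open>Sparse families\<close>

text \<open>The hypotheses place \<open>k\<close> between \<open>q\<close> and \<open>n - q\<close>,
  so unimodality applies, after reflecting \<open>k\<close> if it exceeds the middle.\<close>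

lemma binomial_le_of_le:
  fixes n q k :: nat
  assumes "q \<le> k" "q \<le> n - k" "k \<le> n"
  shows "n choose q \<le> n choose k"
proof (cases "2 * k \<le> n")
  case True
  then show ?thesis using assms by (intro binomial_mono) auto
next
  case False
  then have "n choose q \<le> n choose (n - k)" using assms by (intro binomial_mono) auto
  then show ?thesis using assms binomial_symmetric by metis
qed

text \<open>The levels \<open>1\<close> and \<open>a - 1\<close> contribute \<open>1 / a\<close>
  each. Every other binomial coefficient is at least \<open>a choose 2\<close>, so the remaining
  levels together are again of order \<open>1 / a\<close>.\<close>

lemma sum_inverse_binomial_le:
  assumes "4 \<le> a"
  shows "(\<Sum>j=1..<a. 1 / real (a choose j)) \<le> 4 / real (a - 1)"
proof -
  \<comment> \<open>The two indicator terms absorb the end levels, so that one bound serves for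
    every \<open>j\<close> and can be summed in closed form.\<close>
  have bound: "1 / real (a choose j) \<le>
      (if j = 1 then 1 / real a else 0) + (if j = a - 1 then 1 / real a else 0)
      + 2 / (real a * real (a - 1))" if j: "j \<in> {1..<a}" for j
  proof -
    consider "j = 1" | "j = a - 1" | "2 \<le> j" "2 \<le> a - j" using j assms by atomize_elim auto
    then show ?thesis
    proof cases
      case 2
      have "a choose (a - 1) = a" using assms binomial_symmetric[of 1 a] by simp
      then show ?thesis using 2 assms by simp
    next
      case 3
      then have "a choose 2 \<le> a choose j" using j by (intro binomial_le_of_le) auto
      moreover have "real (a choose 2) = real a * real (a - 1) / 2"
      proof -
        have "2 dvd a * (a - 1)" by (cases "even a") auto
        then show ?thesis unfolding choose_two by (simp only: real_of_nat_div of_nat_mult of_nat_numeral)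
      qed
      ultimately have "real a * real (a - 1) / 2 \<le> real (a choose j)"
        by (metis of_nat_le_iff)
      moreover have "0 < real a * real (a - 1) / 2" using assms by simp
      ultimately have "1 / real (a choose j) \<le> 1 / (real a * real (a - 1) / 2)"
        by (intro frac_le) linarith+
      then show ?thesis using 3 assms by auto
    qed (use assms in simp)
  qed
  have "(\<Sum>j=1..<a. 1 / real (a choose j)) \<le>
    (\<Sum>j=1..<a. (if j = 1 then 1 / real a else 0) + (if j = a - 1 then 1 / real a else 0)
      + 2 / (real a * real (a - 1)))"
    by (rule sum_mono) (rule bound)
  also have "\<dots> = 2 / real a + real (a - 1) * (2 / (real a * real (a - 1)))"
    using assms by (simp add: sum.distrib)
  also have "\<dots> = 4 / real a" using assms by (simp add: field_simps)
  also have "\<dots> \<le> 4 / real (a - 1)" using assms by (intro divide_left_mono) auto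
  finally show ?thesis .
qed

text \<open>With at most \<open>s\<close> sets per level the average number of members on a chain is
  at most \<open>s\<close> times the sum of inverse binomials, hence of order
  \<open>s / card S\<close>. The sets \<open>{}\<close> and \<open>S\<close> are excluded because
  they lie on every chain. The size bound on \<open>S\<close> turns the average into
  \<open>1 / 8\<close>, a quarter of the \<open>1 / 2\<close> available to a window.\<close>

lemma sum_card_sparse_le:
  assumes "finite S" "\<G> \<subseteq> Pow S" "{} \<notin> \<G>" "S \<notin> \<G>"
    and sparse: "\<And>j. card {G \<in> \<G>. card G = j} \<le> s"
    and big: "32 * s + 4 \<le> card S"
  shows "(\<Sum>xs\<in>permutations_of_set S. real (card (\<G> \<inter> prefix_sets xs))) \<le> fact (card S) / 8"
proof -
  let ?a = "card S"
  have fG: "finite \<G>" using assms finite_subset by blast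
  have im: "card ` \<G> \<subseteq> {1..<?a}"
  proof
    fix j assume "j \<in> card ` \<G>"
    then obtain G where G: "G \<in> \<G>" "j = card G" by blast
    then have "G \<subset> S" "G \<noteq> {}" using assms by auto
    then show "j \<in> {1..<?a}"
      using G assms(1) by (auto simp: psubset_card_mono card_gt_0_iff Suc_le_eq finite_subset)
  qed
  have "(\<Sum>G\<in>\<G>. 1 / real (?a choose card G)) =
      (\<Sum>j=1..<?a. \<Sum>G\<in>{G \<in> \<G>. card G = j}. 1 / real (?a choose card G))"
    by (rule sum.group[OF fG _ im, symmetric]) simp
  also have "\<dots> = (\<Sum>j=1..<?a. real (card {G \<in> \<G>. card G = j}) * (1 / real (?a choose j)))"
    by (intro sum.cong refl) simp
  also have "\<dots> \<le> (\<Sum>j=1..<?a. real s * (1 / real (?a choose j)))"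
    using sparse by (intro sum_mono mult_right_mono) auto
  also have "\<dots> = real s * (\<Sum>j=1..<?a. 1 / real (?a choose j))"
    by (simp add: sum_distrib_left)
  also have "\<dots> \<le> real s * (4 / real (?a - 1))"
    using big by (intro mult_left_mono sum_inverse_binomial_le) auto
  also have "\<dots> \<le> 1 / 8" using big by (simp add: field_simps)
  finally have *: "(\<Sum>G\<in>\<G>. 1 / real (?a choose card G)) \<le> 1 / 8" .
  have "(\<Sum>xs\<in>permutations_of_set S. real (card (\<G> \<inter> prefix_sets xs))) =
    fact ?a * (\<Sum>G\<in>\<G>. 1 / real (?a choose card G))"
    using sum_sum_permutations_through[OF assms(1,2), of "\<lambda>_. 1"] by simp
  also have "\<dots> \<le> fact ?a * (1 / 8)" using * by (intro mult_left_mono) auto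
  finally show ?thesis by simp
qed

section \<open>Copies of the posets\<close>

text \<open>Otherwise the \<open>h\<close>-chain together with \<open>s\<close> supersets of its top
  on a common level would be a copy of \<open>Y_poset h s\<close>.\<close>

lemma few_supersets:
  assumes free: "rp_free \<P> \<F>" "Y_poset h s \<in> \<P>"
    and cs: "sorted_wrt (\<subset>) cs" "length cs = h" "set cs \<subseteq> \<F>" and h: "1 \<le> h"
  shows "card {G \<in> \<F>. last cs \<subset> G \<and> card G = j} < s"
proof (rule ccontr)
  assume "\<not> ?thesis"
  then have "s \<le> card {G \<in> \<F>. last cs \<subset> G \<and> card G = j}" by simp
  then obtain V where V: "V \<subseteq> {G \<in> \<F>. last cs \<subset> G \<and> card G = j}" "card V = s" "finite V"
    by (rule obtain_subset_with_card_n)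
  then obtain g where g: "bij_betw g {1..s} V"
    using ex_bij_betw_nat_finite_1 by blast
  define \<phi> where "\<phi> p = (case p of X i \<Rightarrow> cs ! (i - 1) | Y j \<Rightarrow> g j)" for p
  have lt: "cs ! i \<subset> cs ! k" if "i < k" "k < h" for i k
    using that cs sorted_wrt_nth_less by blast
  have le: "cs ! i \<subseteq> cs ! k" if "i \<le> k" "k < h" for i k
    using that lt[of i k] by (cases "i = k") auto
  have gV: "g k \<in> \<F>" "last cs \<subset> g k" "card (g k) = j" if "k \<in> {1..s}" for k
    using that V(1) bij_betwE[OF g] by blast+
  have last: "last cs = cs ! (h - 1)" using cs h by (metis last_conv_nth list.size(3) not_one_le_zero)
  have below: "cs ! (i - 1) \<subset> g k" if "i \<in> {1..h}" "k \<in> {1..s}" for i k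
  proof -
    have "i - 1 \<le> h - 1" "h - 1 < h" using that h by auto
    then have "cs ! (i - 1) \<subseteq> last cs" unfolding last by (rule le)
    then show ?thesis using gV(2)[OF that(2)] by blast
  qed
  have inj: "inj_on \<phi> (elems (Y_poset h s))"
  proof (rule inj_onI)
    fix p q assume p: "p \<in> elems (Y_poset h s)" and q: "q \<in> elems (Y_poset h s)"
      and e: "\<phi> p = \<phi> q"
    show "p = q"
    proof (cases p; cases q)
      fix a b assume pq: "p = X a" "q = X b"
      then have ab: "a \<in> {1..h}" "b \<in> {1..h}" using p q by (auto simp: Y_poset_def)
      have "cs ! (a - 1) = cs ! (b - 1)" using e pq by (simp add: \<phi>_def)
      moreover have "a - 1 < h" "b - 1 < h" using ab by auto
      ultimately have "a - 1 = b - 1"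
        using lt[of "a - 1" "b - 1"] lt[of "b - 1" "a - 1"]
        by (cases "a - 1" "b - 1" rule: linorder_cases) blast+
      then show ?thesis using ab pq by auto
    next
      fix a b assume pq: "p = X a" "q = Y b"
      then show ?thesis using p q e below[of a b] by (auto simp: Y_poset_def \<phi>_def)
    next
      fix a b assume pq: "p = Y a" "q = X b"
      then show ?thesis using p q e below[of b a] by (auto simp: Y_poset_def \<phi>_def)
    next
      fix a b assume pq: "p = Y a" "q = Y b"
      then show ?thesis using p q e bij_betw_imp_inj_on[OF g]
        by (auto simp: Y_poset_def \<phi>_def inj_on_def)
    qed
  qed
  \<comment> \<open>The \<open>X\<close> elements have pairwise distinct ranks, so the rank
    condition only concerns the \<open>Y\<close> elements, all of which are sent to level
    \<open>j\<close>.\<close>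
  have "rank_preserving_copy (Y_poset h s) (\<phi> ` elems (Y_poset h s))"
    unfolding rank_preserving_copy_def
  proof (intro exI[of _ \<phi>] conjI ballI impI)
    show "bij_betw \<phi> (elems (Y_poset h s)) (\<phi> ` elems (Y_poset h s))"
      using inj by (rule inj_on_imp_bij_betw)
  next
    fix p q assume "(p, q) \<in> le (Y_poset h s)"
    then consider (XX) i k where "p = X i" "q = X k" "i \<le> k" "k \<le> h" "1 \<le> i"
      | (XY) i k where "p = X i" "q = Y k" "i \<in> {1..h}" "k \<in> {1..s}" | (eq) "p = q"
      unfolding Y_poset_def by auto
    then show "\<phi> p \<subseteq> \<phi> q"
    proof cases
      case XX
      then have "i - 1 \<le> k - 1" "k - 1 < h" by auto
      then have "cs ! (i - 1) \<subseteq> cs ! (k - 1)" by (rule le)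
      then show ?thesis using XX by (simp add: \<phi>_def)
    next
      case XY
      then show ?thesis using below[of i k] by (simp add: \<phi>_def psubset_imp_subset)
    qed simp
  next
    fix p q assume "p \<in> elems (Y_poset h s)" "q \<in> elems (Y_poset h s)"
      "rank (Y_poset h s) p = rank (Y_poset h s) q"
    then show "card (\<phi> p) = card (\<phi> q)" using gV(3) by (auto simp: Y_poset_def \<phi>_def)
  qed
  moreover have "\<phi> ` elems (Y_poset h s) \<subseteq> \<F>"
    using gV(1) cs by (auto simp: Y_poset_def \<phi>_def subset_iff)
  ultimately show False using free by (auto simp: rp_free_def)
qed

text \<open>Order dual of \<open>few_supersets\<close>: the forbidden configuration is an
  \<open>h\<close>-chain with \<open>s\<close> subsets of its bottom on one level.\<close>

lemma few_subsets:
  assumes free: "rp_free \<P> \<F>" "Y_poset_dual h s \<in> \<P>"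
    and cs: "sorted_wrt (\<subset>) cs" "length cs = h" "set cs \<subseteq> \<F>" and h: "1 \<le> h"
  shows "card {G \<in> \<F>. G \<subset> hd cs \<and> card G = j} < s"
proof (rule ccontr)
  assume "\<not> ?thesis"
  then have "s \<le> card {G \<in> \<F>. G \<subset> hd cs \<and> card G = j}" by simp
  then obtain V where V: "V \<subseteq> {G \<in> \<F>. G \<subset> hd cs \<and> card G = j}" "card V = s" "finite V"
    by (rule obtain_subset_with_card_n)
  then obtain g where g: "bij_betw g {1..s} V"
    using ex_bij_betw_nat_finite_1 by blast
  \<comment> \<open>In the dual order \<open>X 1\<close> is the largest element, so the chain is
    indexed from its top: \<open>X 1\<close> goes to \<open>cs ! (h - 1)\<close> and
    \<open>X h\<close> to \<open>cs ! 0\<close>.\<close>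
  define \<phi> where "\<phi> p = (case p of X i \<Rightarrow> cs ! (h - i) | Y j \<Rightarrow> g j)" for p
  have lt: "cs ! i \<subset> cs ! k" if "i < k" "k < h" for i k
    using that cs sorted_wrt_nth_less by blast
  have le: "cs ! i \<subseteq> cs ! k" if "i \<le> k" "k < h" for i k
    using that lt[of i k] by (cases "i = k") auto
  have gV: "g k \<in> \<F>" "g k \<subset> hd cs" "card (g k) = j" if "k \<in> {1..s}" for k
    using that V(1) bij_betwE[OF g] by blast+
  have hd: "hd cs = cs ! 0" using cs h by (metis hd_conv_nth list.size(3) not_one_le_zero)
  have above: "g k \<subset> cs ! (h - i)" if "i \<in> {1..h}" "k \<in> {1..s}" for i k
  proof -
    have "h - i < h" using that h by auto
    then have "hd cs \<subseteq> cs ! (h - i)" unfolding hd by (intro le) auto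
    then show ?thesis using gV(2)[OF that(2)] by blast
  qed
  have inj: "inj_on \<phi> (elems (Y_poset h s))"
  proof (rule inj_onI)
    fix p q assume p: "p \<in> elems (Y_poset h s)" and q: "q \<in> elems (Y_poset h s)"
      and e: "\<phi> p = \<phi> q"
    show "p = q"
    proof (cases p; cases q)
      fix a b assume pq: "p = X a" "q = X b"
      then have ab: "a \<in> {1..h}" "b \<in> {1..h}" using p q by (auto simp: Y_poset_def)
      have "cs ! (h - a) = cs ! (h - b)" using e pq by (simp add: \<phi>_def)
      then have "h - a = h - b"
        using ab lt[of "h - a" "h - b"] lt[of "h - b" "h - a"]
        by (cases "h - a" "h - b" rule: linorder_cases) auto
      then show ?thesis using ab pq by auto
    next
      fix a b assume pq: "p = X a" "q = Y b"
      then show ?thesis using p q e above[of a b] by (auto simp: Y_poset_def \<phi>_def)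
    next
      fix a b assume pq: "p = Y a" "q = X b"
      then show ?thesis using p q e above[of b a] by (auto simp: Y_poset_def \<phi>_def)
    next
      fix a b assume pq: "p = Y a" "q = Y b"
      then show ?thesis using p q e bij_betw_imp_inj_on[OF g]
        by (auto simp: Y_poset_def \<phi>_def inj_on_def)
    qed
  qed
  have "rank_preserving_copy (Y_poset_dual h s) (\<phi> ` elems (Y_poset h s))"
    unfolding rank_preserving_copy_def
  proof (intro exI[of _ \<phi>] conjI ballI impI)
    show "bij_betw \<phi> (elems (Y_poset_dual h s)) (\<phi> ` elems (Y_poset h s))"
      using inj by (simp add: Y_poset_dual_def inj_on_imp_bij_betw)
  next
    fix p q assume "(p, q) \<in> le (Y_poset_dual h s)"
    then consider (XX) i k where "p = X k" "q = X i" "i \<le> k" "k \<le> h" "1 \<le> i"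
      | (YX) i k where "p = Y k" "q = X i" "i \<in> {1..h}" "k \<in> {1..s}" | (eq) "p = q"
      unfolding Y_poset_dual_def Y_poset_def by auto
    then show "\<phi> p \<subseteq> \<phi> q"
    proof cases
      case XX
      then have "h - k \<le> h - i" "h - i < h" by auto
      then have "cs ! (h - k) \<subseteq> cs ! (h - i)" by (rule le)
      then show ?thesis using XX by (simp add: \<phi>_def)
    next
      case YX
      then show ?thesis using above[of i k] by (simp add: \<phi>_def psubset_imp_subset)
    qed simp
  next
    fix p q assume "p \<in> elems (Y_poset_dual h s)" "q \<in> elems (Y_poset_dual h s)"
      "rank (Y_poset_dual h s) p = rank (Y_poset_dual h s) q"
    then consider "p = q" | a b where "p = Y a" "q = Y b" "a \<in> {1..s}" "b \<in> {1..s}"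
      by (cases p; cases q) (auto simp: Y_poset_dual_def Y_poset_def)
    then show "card (\<phi> p) = card (\<phi> q)" by cases (simp_all add: \<phi>_def gV(3))
  qed
  moreover have "\<phi> ` elems (Y_poset h s) \<subseteq> \<F>"
    using gV(1) cs by (auto simp: Y_poset_def \<phi>_def subset_iff)
  ultimately show False using free by (auto simp: rp_free_def)
qed

section \<open>Sizes of the middle layers, and the absence of copies in them\<close>

lemma layer_range_eq:
  fixes n h :: nat
  assumes "h \<le> n"
  shows "{k. n < 2 * k + h \<and> 2 * k \<le> n + h} = {(n - h) div 2 + 1..(n - h) div 2 + h}"
  using assms by auto

text \<open>A general level function \<open>f\<close> covers both uses: \<open>f = 1\<close> gives
  the number of sets, and the inverse binomial gives the LYM sum.\<close>

lemma sum_middle_layers: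
  fixes f :: "nat \<Rightarrow> 'a::comm_semiring_1"
  assumes "h \<le> n"
  shows "(\<Sum>A\<in>middle_layers n h. f (card A)) =
    (\<Sum>i=1..h. of_nat (n choose ((n - h) div 2 + i)) * f ((n - h) div 2 + i))"
proof -
  let ?m = "(n - h) div 2"
  have "middle_layers n h =
      (\<Union>k\<in>{k. n < 2 * k + h \<and> 2 * k \<le> n + h}. {A. A \<subseteq> {1..n} \<and> card A = k})"
    by (auto simp: middle_layers_def)
  also have "\<dots> = (\<Union>k\<in>{?m + 1..?m + h}. {A. A \<subseteq> {1..n} \<and> card A = k})"
    unfolding layer_range_eq[OF assms] ..
  finally have "(\<Sum>A\<in>middle_layers n h. f (card A)) =
      (\<Sum>k=?m + 1..?m + h. \<Sum>A | A \<subseteq> {1..n} \<and> card A = k. f (card A))"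
    by (simp only:) (intro sum.UNION_disjoint; auto)
  also have "\<dots> = (\<Sum>k=1 + ?m..h + ?m. of_nat (n choose k) * f k)"
    by (simp add: n_subsets add.commute)
  also have "\<dots> = (\<Sum>i=1..h. of_nat (n choose (i + ?m)) * f (i + ?m))"
    by (rule sum.shift_bounds_cl_nat_ivl)
  finally show ?thesis by (simp add: add.commute)
qed

lemma Sigma_layers_eq_sum:
  assumes "h \<le> n"
  shows "Sigma_layers n h = (\<Sum>i=1..h. n choose ((n - h) div 2 + i))"
  using sum_middle_layers[OF assms, of "\<lambda>_. 1 :: nat"] by (simp add: Sigma_layers_def)

lemma sum_inverse_binomial_middle_layers:
  assumes "h \<le> n"
  shows "(\<Sum>A\<in>middle_layers n h. 1 / real (n choose card A)) = real h"
proof -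
  have "(\<Sum>A\<in>middle_layers n h. 1 / real (n choose card A)) =
    (\<Sum>i=1..h. real (n choose ((n - h) div 2 + i)) * (1 / real (n choose ((n - h) div 2 + i))))"
    using sum_middle_layers[OF assms, of "\<lambda>k. 1 / real (n choose k)"] by simp
  also have "\<dots> = (\<Sum>i=1..h. 1)"
  proof (intro sum.cong refl)
    fix i assume "i \<in> {1..h}"
    then have "(n - h) div 2 + i \<le> n" using assms by auto
    then show "real (n choose ((n - h) div 2 + i)) * (1 / real (n choose ((n - h) div 2 + i))) = 1"
      by simp
  qed
  finally show ?thesis by simp
qed

text \<open>Either poset contains a chain of \<open>h + 1\<close> elements, namely all
  \<open>X i\<close> and \<open>Y 1\<close>. Its images are distinct and pairwise comparable, hence
  of distinct sizes, but only \<open>h\<close> sizes occur.\<close>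

lemma middle_layers_no_copy:
  assumes "h \<le> n" "1 \<le> s" and P: "P \<in> {Y_poset h s, Y_poset_dual h s}"
    and "\<G> \<subseteq> middle_layers n h" "rank_preserving_copy P \<G>"
  shows False
proof -
  obtain \<phi> where bij: "bij_betw \<phi> (elems P) \<G>"
    and mono: "\<And>x y. x \<in> elems P \<Longrightarrow> y \<in> elems P \<Longrightarrow> (x, y) \<in> le P \<Longrightarrow> \<phi> x \<subseteq> \<phi> y"
    using assms(5) by (auto simp: rank_preserving_copy_def)
  let ?E = "X ` {1..h} \<union> {Y 1}"
  have E: "?E \<subseteq> elems P" using assms(2) P by (auto simp: Y_poset_dual_def Y_poset_def)
  have total: "(x, y) \<in> le P \<or> (y, x) \<in> le P" if "x \<in> ?E" "y \<in> ?E" for x y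
    using that P assms(2) by (auto simp: Y_poset_dual_def Y_poset_def)
  have mid: "\<phi> x \<subseteq> {1..n}" "card (\<phi> x) \<in> {k. n < 2 * k + h \<and> 2 * k \<le> n + h}"
    if "x \<in> ?E" for x
    using that E bij_betwE[OF bij] assms(4) by (auto simp: middle_layers_def)
  have inj: "inj_on (\<lambda>x. card (\<phi> x)) ?E"
  proof (rule inj_onI)
    fix x y assume xy: "x \<in> ?E" "y \<in> ?E" and e: "card (\<phi> x) = card (\<phi> y)"
    have "\<phi> x \<subseteq> \<phi> y \<or> \<phi> y \<subseteq> \<phi> x" using total[OF xy] mono E xy by blast
    then have "\<phi> x = \<phi> y"
      using e mid(1)[OF xy(1)] mid(1)[OF xy(2)] by (metis card_subset_eq finite_atLeastAtMost finite_subset)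
    then show "x = y" using bij_betw_imp_inj_on[OF bij] E xy by (meson inj_onD subsetD)
  qed
  have "card ?E \<le> card {(n - h) div 2 + 1..(n - h) div 2 + h}"
    using mid(2) unfolding layer_range_eq[OF assms(1)] by (intro card_inj_on_le[OF inj]) blast+
  moreover have "card ?E = h + 1"
    by (subst card_Un_disjoint) (auto simp: card_image inj_on_def)
  ultimately show False by simp
qed

section \<open>The weighted LYM inequality\<close>

text \<open>Levels within distance less than \<open>r\<close> of the bottom or the top count as far.
  The lower bound on \<open>r\<close> makes \<open>sum_card_sparse_le\<close> applicable both below
  and above any set that is not far.\<close>

locale Y_free_family =
  fixes n h s r :: nat and \<F> :: "nat set set"
  assumes family: "\<F> \<subseteq> Pow {1..n}"
    and free: "rp_free {Y_poset h s, Y_poset_dual h s} \<F>"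
    and h: "2 \<le> h" and r: "32 * s + 4 \<le> r" and n: "2 * r \<le> n"
begin

definition core :: "nat set set" where
  "core = {A \<in> \<F>. r \<le> card A \<and> card A + r \<le> n}"

text \<open>Only the end of the chain has to lie in the core. The other members may be far, so a far
  member can also serve to make a core set upper.\<close>

definition uppers :: "nat set set" where
  "uppers = {B \<in> core. \<exists>cs. sorted_wrt (\<subset>) cs \<and> length cs = h \<and> set cs \<subseteq> \<F> \<and> last cs = B}"

definition lowers :: "nat set set" where
  "lowers = {A \<in> core. \<exists>cs. sorted_wrt (\<subset>) cs \<and> length cs = h \<and> set cs \<subseteq> \<F> \<and> hd cs = A}"

text \<open>The count \<open>h - 1\<close> is one less than the chain length in
  \<open>uppers\<close> and \<open>lowers\<close>: consecutive core members, extended by one member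
  of the family on either side, supply a window.\<close>

definition windows :: "nat list \<Rightarrow> (nat set \<times> nat set) set" where
  "windows xs = {(A, B). A \<in> lowers \<and> B \<in> uppers \<and> A \<subseteq> B \<and> A \<in> prefix_sets xs \<and>
     B \<in> prefix_sets xs \<and> card {G \<in> core \<inter> prefix_sets xs. A \<subseteq> G \<and> G \<subseteq> B} = h - 1}"

section \<open>Windows: averages over chains, then the balance on a single chain\<close>

lemma finite_family: "finite \<F>"
  using family finite_subset by blast

lemma core_subset: "core \<subseteq> \<F>"
  by (auto simp: core_def)

lemma finite_core: "finite core"
  using core_subset finite_family finite_subset by blast

lemma core_Pow: "G \<in> core \<Longrightarrow> G \<subseteq> {1..n}"
  using core_subset family by blast

text \<open>A lower set is the bottom of an \<open>h\<close>-chain, so by \<open>few_subsets\<close>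
  the family is sparse below it. Being in the core, \<open>A\<close> is large enough for the average
  to drop to \<open>1 / 8\<close>.\<close>

lemma sum_core_below_le:
  assumes "A \<in> lowers"
  shows "(\<Sum>u\<in>permutations_of_set A. real (card ({G \<in> core. G \<subset> A} \<inter> prefix_sets u)))
    \<le> fact (card A) / 8"
proof (rule sum_card_sparse_le)
  obtain cs where cs: "sorted_wrt (\<subset>) cs" "length cs = h" "set cs \<subseteq> \<F>" "hd cs = A"
    and A: "A \<in> core" using assms by (auto simp: lowers_def)
  show "finite A" using core_Pow[OF A] finite_subset by blast
  show "{} \<notin> {G \<in> core. G \<subset> A}" using r by (auto simp: core_def)
  show "32 * s + 4 \<le> card A" using r A by (auto simp: core_def)
  fix j
  have "card {G \<in> {G \<in> core. G \<subset> A}. card G = j} \<le> card {G \<in> \<F>. G \<subset> hd cs \<and> card G = j}"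
    using finite_family cs by (intro card_mono) (auto simp: core_def)
  also have "\<dots> < s"
    using few_subsets[OF free _ cs(1-3)] h by simp
  finally show "card {G \<in> {G \<in> core. G \<subset> A}. card G = j} \<le> s" by simp
qed auto

text \<open>Dual to \<open>sum_core_below_le\<close>. Subtracting \<open>B\<close> moves the
  supersets of \<open>B\<close> into the cube over the complement, where size
  \<open>card B + j\<close> becomes level \<open>j\<close>.\<close>

lemma sum_core_above_le:
  assumes "B \<in> uppers"
  shows "(\<Sum>w\<in>permutations_of_set ({1..n} - B).
      real (card ((\<lambda>G. G - B) ` {G \<in> core. B \<subset> G} \<inter> prefix_sets w)))
    \<le> fact (card ({1..n} - B)) / 8"
proof (rule sum_card_sparse_le)
  obtain cs where cs: "sorted_wrt (\<subset>) cs" "length cs = h" "set cs \<subseteq> \<F>" "last cs = B"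
    and B: "B \<in> core" using assms by (auto simp: uppers_def)
  have finB: "finite B" using core_Pow[OF B] finite_subset by blast
  let ?G = "(\<lambda>G. G - B) ` {G \<in> core. B \<subset> G}"
  have cardB: "card ({1..n} - B) = n - card B"
    using core_Pow[OF B] finB by (simp add: card_Diff_subset)
  show "?G \<subseteq> Pow ({1..n} - B)" using core_Pow by blast
  show "{} \<notin> ?G" by auto
  show "{1..n} - B \<notin> ?G"
  proof
    assume "{1..n} - B \<in> ?G"
    then obtain G where G: "G \<in> core" "B \<subset> G" "{1..n} - B = G - B" by blast
    then have "G = {1..n}" using core_Pow[of G] core_Pow[OF B] by blast
    with G(1) show False using r by (simp add: core_def)
  qed
  show "32 * s + 4 \<le> card ({1..n} - B)" using r B cardB by (auto simp: core_def)
  fix j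
  have "card {G \<in> ?G. card G = j} \<le> card {G \<in> \<F>. last cs \<subset> G \<and> card G = card B + j}"
  proof (rule surj_card_le)
    show "finite {G \<in> \<F>. last cs \<subset> G \<and> card G = card B + j}" using finite_family by simp
    show "{G \<in> ?G. card G = j} \<subseteq> (\<lambda>G. G - B) ` {G \<in> \<F>. last cs \<subset> G \<and> card G = card B + j}"
    proof
      fix H assume "H \<in> {G \<in> ?G. card G = j}"
      then obtain G where G: "G \<in> core" "B \<subset> G" "H = G - B" "card H = j" by blast
      have "finite G" using core_Pow[OF G(1)] finite_subset by blast
      then have "card G = card B + j"
        using G finB card_Diff_subset[of B G] card_mono[of G B] by auto
      then show "H \<in> (\<lambda>G. G - B) ` {G \<in> \<F>. last cs \<subset> G \<and> card G = card B + j}"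
        using G cs core_subset by blast
    qed
  qed
  also have "\<dots> < s"
    using few_supersets[OF free _ cs(1-3)] h by simp
  finally show "card {G \<in> ?G. card G = j} \<le> s" by simp
qed auto

text \<open>A random chain through \<open>A\<close> and \<open>B\<close> consists of three independent pieces. Whether
  \<open>(A, B)\<close> is a window depends on the middle one only, and the outer two rarely meet the family.\<close>

lemma sum_window_le_0:
  assumes A: "A \<in> lowers" and B: "B \<in> uppers" and AB: "A \<subseteq> B"
  shows "(\<Sum>xs | xs \<in> permutations_of_set {1..n} \<and> A \<in> prefix_sets xs \<and> B \<in> prefix_sets xs.
      if card {G \<in> core \<inter> prefix_sets xs. A \<subseteq> G \<and> G \<subseteq> B} = h - 1
      then 2 * (real (card (core \<inter> prefix_sets xs)) - real (h - 1)) - 1 / 2 else 0) \<le> 0"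
    (is "sum ?f _ \<le> 0")
proof -
  have BS: "B \<subseteq> {1..n}" using B core_Pow by (auto simp: uppers_def)
  have fins: "finite A" "finite B" using BS AB by (meson finite_atLeastAtMost finite_subset)+
  \<comment> \<open>\<open>b\<close>, \<open>m\<close> and \<open>a\<close> count the core members
    strictly below \<open>A\<close>, between \<open>A\<close> and \<open>B\<close>, and strictly
    above \<open>B\<close>. Each depends on a single piece of the permutation, and for a window
    \<open>b + a\<close> is exactly the surplus over \<open>h - 1\<close>.\<close>
  define b where "b u = real (card ({G \<in> core. G \<subset> A} \<inter> prefix_sets u))" for u
  define a where "a w = real (card ((\<lambda>G. G - B) ` {G \<in> core. B \<subset> G} \<inter> prefix_sets w))" for w
  define m where "m v = card {G \<in> core. A \<subseteq> G \<and> G \<subseteq> B \<and> G - A \<in> prefix_sets v}" for v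
  define PA where "PA = permutations_of_set A"
  define PM where "PM = permutations_of_set (B - A)"
  define PB where "PB = permutations_of_set ({1..n} - B)"
  have f_eq: "?f (u @ v @ w) = (if m v = h - 1 then 2 * (b u + a w) - 1 / 2 else 0)"
    if "u \<in> PA" "v \<in> PM" "w \<in> PB" for u v w
  proof -
    have sets: "set u = A" "set v = B - A" "set w = {1..n} - B"
      using that by (auto simp: PA_def PM_def PB_def permutations_of_set_def)
    let ?xs = "u @ v @ w"
    let ?L = "{G \<in> core. G \<subset> A} \<inter> prefix_sets u"
    let ?M = "{G \<in> core \<inter> prefix_sets ?xs. A \<subseteq> G \<and> G \<subseteq> B}"
    let ?U = "{G \<in> core. B \<subset> G \<and> G - B \<in> prefix_sets w}"
    have uv: "set (u @ v) = B" using sets AB by auto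
    have low: "G \<in> prefix_sets ?xs \<longleftrightarrow> G \<in> prefix_sets u" if "G \<subset> A" for G
      using that sets by (intro prefix_sets_append_lower) auto
    have mid: "G \<in> prefix_sets ?xs \<longleftrightarrow> G - A \<in> prefix_sets v" if "A \<subseteq> G" "G \<subseteq> B" for G
    proof -
      have "G \<in> prefix_sets ?xs \<longleftrightarrow> G - A \<in> prefix_sets (v @ w)"
        using that sets AB prefix_sets_append_upper[of u G "v @ w"] by auto
      also have "\<dots> \<longleftrightarrow> G - A \<in> prefix_sets v"
        using that sets by (intro prefix_sets_append_lower) auto
      finally show ?thesis .
    qed
    have up: "G \<in> prefix_sets ?xs \<longleftrightarrow> G - B \<in> prefix_sets w" if "B \<subset> G" for G
      using that uv sets prefix_sets_append_upper[of "u @ v" G w] by auto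
    have AX: "A \<in> prefix_sets ?xs" using mid[of A] AB empty_in_prefix_sets by simp
    have BX: "B \<in> prefix_sets ?xs" using mid[of B] AB set_in_prefix_sets[of v] sets by simp
    have split: "core \<inter> prefix_sets ?xs = ?L \<union> ?M \<union> ?U"
    proof (intro set_eqI iffI)
      fix G assume G: "G \<in> core \<inter> prefix_sets ?xs"
      then consider "G \<subset> A" | "B \<subset> G" | "A \<subseteq> G" "G \<subseteq> B"
        using prefix_sets_linear[OF _ AX, of G] prefix_sets_linear[OF _ BX, of G] by blast
      then show "G \<in> ?L \<union> ?M \<union> ?U" using G low[of G] up[of G] by cases simp_all
    next
      fix G assume "G \<in> ?L \<union> ?M \<union> ?U"
      then show "G \<in> core \<inter> prefix_sets ?xs" using low[of G] up[of G] by auto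
    qed
    have parts: "card (?L \<union> ?M \<union> ?U) = card ?L + card ?M + card ?U"
    proof -
      have "finite ?L" "finite ?M" "finite ?U" using finite_core by auto
      moreover have "?L \<inter> ?M = {}" "(?L \<union> ?M) \<inter> ?U = {}" using AB by blast+
      ultimately show ?thesis by (simp add: card_Un_disjoint)
    qed
    have "?M = {G \<in> core. A \<subseteq> G \<and> G \<subseteq> B \<and> G - A \<in> prefix_sets v}"
      using mid by blast
    then have M: "card ?M = m v" unfolding m_def by (rule arg_cong)
    have U: "card ?U = card ((\<lambda>G. G - B) ` {G \<in> core. B \<subset> G} \<inter> prefix_sets w)"
    proof -
      have "(\<lambda>G. G - B) ` {G \<in> core. B \<subset> G} \<inter> prefix_sets w = (\<lambda>G. G - B) ` ?U" by blast
      moreover have "inj_on (\<lambda>G. G - B) ?U" by (rule inj_onI) blast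
      ultimately show ?thesis by (simp add: card_image)
    qed
    have "card (core \<inter> prefix_sets ?xs) = card (?L \<union> ?M \<union> ?U)"
      using split by (rule arg_cong)
    also note parts
    finally have "real (card (core \<inter> prefix_sets ?xs)) = b u + real (m v) + a w"
      by (simp only: M U b_def a_def of_nat_add)
    then show ?thesis unfolding M by simp
  qed
  \<comment> \<open>The averages of \<open>b\<close> and \<open>a\<close> are at most
    \<open>1 / 8\<close> each, and \<open>2 * (1 / 8 + 1 / 8)\<close> is cancelled by the
    \<open>1 / 2\<close>.\<close>
  have inner: "(\<Sum>u\<in>PA. \<Sum>w\<in>PB. 2 * (b u + a w) - 1 / 2) \<le> 0"
  proof -
    have cA: "real (card PA) = fact (card A)" and cB: "real (card PB) = fact (card ({1..n} - B))"
      using fins by (simp_all add: PA_def PB_def)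
    have bA: "sum b PA \<le> real (card PA) / 8"
      using sum_core_below_le[OF A] unfolding cA by (simp add: b_def PA_def)
    have aB: "sum a PB \<le> real (card PB) / 8"
      using sum_core_above_le[OF B] unfolding cB by (simp add: a_def PB_def)
    have "(\<Sum>u\<in>PA. \<Sum>w\<in>PB. 2 * (b u + a w) - 1 / 2) =
      2 * (real (card PB) * sum b PA) + 2 * (real (card PA) * sum a PB)
        - real (card PA) * real (card PB) / 2"
      by (simp add: sum.distrib sum_subtractf sum_distrib_left[symmetric] sum_distrib_right[symmetric]
          algebra_simps)
    also have "\<dots> \<le> 2 * (real (card PB) * (real (card PA) / 8))
      + 2 * (real (card PA) * (real (card PB) / 8)) - real (card PA) * real (card PB) / 2"
      using bA aB by (intro diff_right_mono add_mono mult_left_mono) auto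
    also have "\<dots> = 0" by simp
    finally show ?thesis .
  qed
  have "(\<Sum>xs | xs \<in> permutations_of_set {1..n} \<and> A \<in> prefix_sets xs \<and> B \<in> prefix_sets xs. ?f xs)
    = (\<Sum>u\<in>PA. \<Sum>v\<in>PM. \<Sum>w\<in>PB. ?f (u @ v @ w))"
    unfolding PA_def PM_def PB_def by (rule sum_permutations_through_pair[OF AB BS])
  also have "\<dots> = (\<Sum>u\<in>PA. \<Sum>v\<in>PM. \<Sum>w\<in>PB. if m v = h - 1 then 2 * (b u + a w) - 1 / 2 else 0)"
    by (intro sum.cong refl f_eq)
  also have "\<dots> = (\<Sum>v\<in>PM. \<Sum>u\<in>PA. \<Sum>w\<in>PB. if m v = h - 1 then 2 * (b u + a w) - 1 / 2 else 0)"
    by (rule sum.swap)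
  also have "\<dots> \<le> 0"
  proof (rule sum_nonpos)
    fix v
    show "(\<Sum>u\<in>PA. \<Sum>w\<in>PB. if m v = h - 1 then 2 * (b u + a w) - 1 / 2 else 0) \<le> 0"
      using inner by (cases "m v = h - 1") auto
  qed
  finally show ?thesis .
qed

lemma finite_windows: "finite (windows xs)"
  by (rule finite_subset[of _ "core \<times> core"])
    (auto simp: windows_def lowers_def uppers_def finite_core)

text \<open>Exchanging the sums fixes the pair \<open>(A, B)\<close> first, and
  \<open>sum_window_le_0\<close> then handles each pair separately.\<close>

lemma sum_windows_le_0:
  "(\<Sum>xs\<in>permutations_of_set {1..n}. \<Sum>p\<in>windows xs.
      2 * (real (card (core \<inter> prefix_sets xs)) - real (h - 1)) - 1 / 2) \<le> 0"
proof -
  define Q where "Q = {(A, B). A \<in> lowers \<and> B \<in> uppers \<and> A \<subseteq> B}"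
  define c where "c xs = 2 * (real (card (core \<inter> prefix_sets xs)) - real (h - 1)) - 1 / 2" for xs
  define W where "W xs p \<longleftrightarrow> fst p \<in> prefix_sets xs \<and> snd p \<in> prefix_sets xs \<and>
      card {G \<in> core \<inter> prefix_sets xs. fst p \<subseteq> G \<and> G \<subseteq> snd p} = h - 1" for xs p
  have fQ: "finite Q"
    by (rule finite_subset[of _ "core \<times> core"])
      (auto simp: Q_def lowers_def uppers_def finite_core)
  have win: "windows xs = {p \<in> Q. W xs p}" for xs
    by (auto simp: windows_def Q_def W_def)
  have "(\<Sum>xs\<in>permutations_of_set {1..n}. \<Sum>p\<in>windows xs. c xs) =
    (\<Sum>xs\<in>permutations_of_set {1..n}. \<Sum>p\<in>Q. if W xs p then c xs else 0)"
    unfolding win using fQ by (intro sum.cong refl sum.inter_filter)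
  also have "\<dots> = (\<Sum>p\<in>Q. \<Sum>xs\<in>permutations_of_set {1..n}. if W xs p then c xs else 0)"
    by (rule sum.swap)
  also have "\<dots> \<le> 0"
  proof (rule sum_nonpos)
    fix p assume "p \<in> Q"
    then obtain A B where p: "p = (A, B)" "A \<in> lowers" "B \<in> uppers" "A \<subseteq> B" by (auto simp: Q_def)
    have "(\<Sum>xs\<in>permutations_of_set {1..n}. if W xs p then c xs else 0) =
      (\<Sum>xs\<in>{xs \<in> permutations_of_set {1..n}. A \<in> prefix_sets xs \<and> B \<in> prefix_sets xs}.
        if card {G \<in> core \<inter> prefix_sets xs. A \<subseteq> G \<and> G \<subseteq> B} = h - 1 then c xs else 0)"
      by (subst sum.inter_filter) (auto simp: W_def p intro!: sum.cong)
    also have "\<dots> \<le> 0"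
      unfolding c_def by (rule sum_window_le_0[OF p(2-4)])
    finally show "(\<Sum>xs\<in>permutations_of_set {1..n}. if W xs p then c xs else 0) \<le> 0" .
  qed
  finally show ?thesis unfolding c_def .
qed

text \<open>Among the members on the chain one finds \<open>h - 1\<close> consecutive core members
  \<open>W\<close> with a further member before and after them. The predecessor followed by
  \<open>W\<close> shows that \<open>last W\<close> is upper, and \<open>W\<close> followed by the
  successor shows that \<open>hd W\<close> is lower.\<close>

lemma windows_nonempty:
  assumes xs: "xs \<in> permutations_of_set {1..n}"
    and many: "h \<le> card (core \<inter> prefix_sets xs)" "h + 1 \<le> card (\<F> \<inter> prefix_sets xs)"
  shows "windows xs \<noteq> {}"
proof -
  have len: "length xs = n" using length_finite_permutations_of_set[OF xs] by simp
  have dist: "distinct xs" using permutations_of_setD[OF xs] by simp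
  define t where "t k = set (take k xs)" for k
  have card_t: "card (t k) = k" if "k \<le> n" for k
    using that dist len by (simp add: t_def distinct_card)
  have t_less: "t i \<subset> t k" if "i < k" "k \<le> n" for i k
    using that card_t[of i] card_t[of k] set_take_subset_set_take[of i k xs] by (auto simp: t_def)
  \<comment> \<open>\<open>P\<close>, \<open>L\<close> and \<open>Q\<close> list the members on the
    chain in increasing order: those far below, those in the core, and those far above.\<close>
  define fl where "fl ks = filter (\<lambda>G. G \<in> \<F>) (map t ks)" for ks
  define P where "P = fl [0..<r]"
  define L where "L = fl [r..<n - r + 1]"
  define Q where "Q = fl [n - r + 1..<n + 1]"
  have upt_split: "[i..<k] = [i..<j] @ [j..<k]" if "i \<le> j" "j \<le> k" for i j k :: nat
    using that upt_add_eq_append[of i j "k - j"] by simp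
  have upt: "[0..<n + 1] = [0..<r] @ [r..<n - r + 1] @ [n - r + 1..<n + 1]"
    using n upt_split[of 0 r "n + 1"] upt_split[of r "n - r + 1" "n + 1"] by simp
  have PLQ: "fl [0..<n + 1] = P @ L @ Q"
    unfolding upt by (simp add: fl_def P_def L_def Q_def)
  have "sorted_wrt (\<subset>) (map t [0..<n + 1])"
    unfolding sorted_wrt_map
    by (rule sorted_wrt_mono_rel[OF _ sorted_wrt_upt]) (rule t_less; auto)
  then have sorted: "sorted_wrt (\<subset>) (P @ L @ Q)"
    unfolding PLQ[symmetric] fl_def by (rule sorted_wrt_filter)
  have pre: "prefix_sets xs = t ` {..n}"
  proof (intro equalityI subsetI)
    fix G assume "G \<in> prefix_sets xs"
    then obtain k where "G = t k" by (auto simp: prefix_sets_def t_def)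
    then have "G = t (min k n)" using len by (simp add: t_def min_def)
    then show "G \<in> t ` {..n}" by auto
  qed (auto simp: prefix_sets_def t_def)
  have setF: "set (P @ L @ Q) = \<F> \<inter> prefix_sets xs"
  proof -
    have "set [0..<n + 1] = {..n}" by auto
    then show ?thesis unfolding PLQ[symmetric] fl_def pre set_filter set_map by blast
  qed
  have setL: "set L = core \<inter> prefix_sets xs"
  proof -
    have "core \<inter> prefix_sets xs = {G \<in> \<F>. G \<in> t ` {r..<n - r + 1}}"
    proof (intro equalityI subsetI)
      fix G assume "G \<in> core \<inter> prefix_sets xs"
      then obtain k where "k \<le> n" "G = t k" "G \<in> core" unfolding pre by auto
      then show "G \<in> {G \<in> \<F>. G \<in> t ` {r..<n - r + 1}}"
        using card_t[of k] by (auto simp: core_def)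
    next
      fix G assume "G \<in> {G \<in> \<F>. G \<in> t ` {r..<n - r + 1}}"
      then obtain k where k: "r \<le> k" "k \<le> n - r" "G = t k" "G \<in> \<F>" by auto
      then have "k \<le> n" by simp
      with k show "G \<in> core \<inter> prefix_sets xs"
        using card_t[of k] n unfolding pre by (auto simp: core_def)
    qed
    then show ?thesis unfolding L_def fl_def set_filter set_map set_upt by blast
  qed
  have dist_sorted: "distinct cs" if "sorted_wrt (\<subset>) cs" for cs :: "nat set list"
    using that by (induction cs) auto
  have lenL: "h \<le> length L"
    using many(1) unfolding setL[symmetric] by (meson card_length le_trans)
  have lenF: "h + 1 \<le> length (P @ L @ Q)"
    using many(2) unfolding setF[symmetric] by (meson card_length le_trans)
  \<comment> \<open>If some far member lies below, \<open>W\<close> starts at the first core member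
    and the next core member follows it. Otherwise the first core member is the predecessor, and
    having at least \<open>h + 1\<close> members in all leaves one after \<open>W\<close>.\<close>
  obtain p W q where L: "L = p @ W @ q" and W: "length W = h - 1"
    and below: "P @ p \<noteq> []" and above: "q @ Q \<noteq> []"
  proof (cases "P = []")
    case False
    have "L = [] @ take (h - 1) L @ drop (h - 1) L" by simp
    moreover have "length (take (h - 1) L) = h - 1" "drop (h - 1) L \<noteq> []"
      using lenL h by auto
    ultimately show ?thesis using False that by blast
  next
    case True
    have "L = take 1 L @ take (h - 1) (drop 1 L) @ drop (h - 1) (drop 1 L)"
      by (simp only: append_take_drop_id)
    moreover have "length (take (h - 1) (drop 1 L)) = h - 1" "take 1 L \<noteq> []"
      using lenL h by auto
    moreover have "drop (h - 1) (drop 1 L) @ Q \<noteq> []" using True lenF h by auto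
    ultimately show ?thesis using that by blast
  qed
  have Wne: "W \<noteq> []" using W h by auto
  have srt: "sorted_wrt (\<subset>) ((P @ p) @ W @ (q @ Q))" using sorted L by simp
  have sub: "set ((P @ p) @ W @ (q @ Q)) \<subseteq> \<F>" using setF L by auto
  have "last (P @ p) \<in> set (P @ p)" using below by (rule last_in_set)
  then have up: "sorted_wrt (\<subset>) (last (P @ p) # W)" "set (last (P @ p) # W) \<subseteq> \<F>"
    using srt sub unfolding sorted_wrt_append by auto
  have "hd (q @ Q) \<in> set (q @ Q)" using above by (rule hd_in_set)
  then have lo: "sorted_wrt (\<subset>) (W @ [hd (q @ Q)])" "set (W @ [hd (q @ Q)]) \<subseteq> \<F>"
    using srt sub unfolding sorted_wrt_append by auto
  have Wcore: "set W \<subseteq> core \<inter> prefix_sets xs" using setL L by auto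
  have hd_le: "hd W \<subseteq> G" and le_last: "G \<subseteq> last W" if G: "G \<in> set W" for G
  proof -
    have sW: "sorted_wrt (\<subset>) W" using srt by (simp add: sorted_wrt_append)
    obtain i where i: "i < length W" "G = W ! i" using G by (auto simp: in_set_conv_nth)
    show "hd W \<subseteq> G"
      using i sorted_wrt_nth_less[OF sW, of 0 i] Wne by (cases "i = 0") (auto simp: hd_conv_nth)
    show "G \<subseteq> last W"
    proof (cases "i = length W - 1")
      case False
      then have "i < length W - 1" "length W - 1 < length W" using i by auto
      then have "W ! i \<subset> W ! (length W - 1)" by (rule sorted_wrt_nth_less[OF sW])
      then show ?thesis using i Wne by (auto simp: last_conv_nth)
    qed (use i Wne in \<open>simp add: last_conv_nth\<close>)
  qed
  \<comment> \<open>The members of \<open>W\<close> are consecutive in \<open>L\<close>, so no other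
    core member on the chain lies between its ends.\<close>
  have inner: "{G \<in> core \<inter> prefix_sets xs. hd W \<subseteq> G \<and> G \<subseteq> last W} = set W"
  proof (intro equalityI subsetI)
    fix G assume G: "G \<in> {G \<in> core \<inter> prefix_sets xs. hd W \<subseteq> G \<and> G \<subseteq> last W}"
    then have "G \<in> set p \<union> set W \<union> set q" using setL L by auto
    moreover have "G \<subset> hd W" if "G \<in> set p"
      using that srt hd_in_set[OF Wne] by (simp add: sorted_wrt_append)
    then have "G \<notin> set p" using G by blast
    moreover have "last W \<subset> G" if "G \<in> set q"
      using that srt last_in_set[OF Wne] by (simp add: sorted_wrt_append)
    then have "G \<notin> set q" using G by blast
    ultimately show "G \<in> set W" by blast
  qed (use Wcore hd_le le_last in auto)
  have "card (set W) = h - 1"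
    using dist_sorted[of W] srt W by (simp add: sorted_wrt_append distinct_card)
  moreover have "last W \<in> uppers"
    unfolding uppers_def using up Wcore last_in_set[OF Wne] W Wne h
    by (auto intro!: exI[of _ "last (P @ p) # W"])
  moreover have "hd W \<in> lowers"
    unfolding lowers_def using lo Wcore hd_in_set[OF Wne] W Wne h
    by (auto intro!: exI[of _ "W @ [hd (q @ Q)]"])
  ultimately have "(hd W, last W) \<in> windows xs"
    unfolding windows_def inner[symmetric]
    using Wcore hd_in_set[OF Wne] last_in_set[OF Wne] hd_le[OF last_in_set[OF Wne]] by auto
  then show ?thesis by blast
qed

text \<open>With only \<open>h - 1\<close> core members on the chain, a window must span all of
  them, so \<open>A\<close> is the smallest and \<open>B\<close> the largest. The penalty
  \<open>- 1 / 2\<close> is therefore incurred at most once.\<close>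

lemma windows_unique:
  assumes "card (core \<inter> prefix_sets xs) = h - 1" "p \<in> windows xs" "q \<in> windows xs"
  shows "p = q"
proof -
  have extreme: "A \<subseteq> G \<and> G \<subseteq> B" if w: "(A, B) \<in> windows xs" and G: "G \<in> core \<inter> prefix_sets xs" for A B G
  proof -
    have "{G \<in> core \<inter> prefix_sets xs. A \<subseteq> G \<and> G \<subseteq> B} = core \<inter> prefix_sets xs"
      using w assms(1) finite_core by (intro card_subset_eq) (auto simp: windows_def)
    with G show ?thesis by blast
  qed
  obtain A B A' B' where pq: "p = (A, B)" "q = (A', B')" by fastforce
  have "{A, B, A', B'} \<subseteq> core \<inter> prefix_sets xs"
    using assms(2,3) unfolding pq by (auto simp: windows_def lowers_def uppers_def)
  then have "A = A'" "B = B'"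
    using extreme[OF assms(2)[unfolded pq]] extreme[OF assms(3)[unfolded pq]]
    by (simp_all add: subset_antisym)
  then show ?thesis by (simp add: pq)
qed

text \<open>With \<open>x\<close> core members on the chain, each window contributes
  \<open>2 * (x - (h - 1)) - 1 / 2\<close>. This is \<open>- 1 / 2\<close> for
  \<open>x = h - 1\<close>, which the left side cannot exceed. For \<open>x\<close> at least
  \<open>h\<close> it is positive and at least \<open>x + 1 / 2 - h\<close>, so a single window pays
  for the whole chain.\<close>

lemma chain_weight_le:
  fixes e :: "nat set \<Rightarrow> real"
  assumes xs: "xs \<in> permutations_of_set {1..n}"
    and small: "(\<Sum>G\<in>(\<F> - core) \<inter> prefix_sets xs. e G) \<le> 1 / 2"
  shows "real (card (core \<inter> prefix_sets xs)) + (\<Sum>G\<in>(\<F> - core) \<inter> prefix_sets xs. e G) - real h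
    \<le> (\<Sum>p\<in>windows xs. 2 * (real (card (core \<inter> prefix_sets xs)) - real (h - 1)) - 1 / 2)"
proof -
  let ?x = "card (core \<inter> prefix_sets xs)"
  let ?c = "2 * (real ?x - real (h - 1)) - 1 / 2"
  have sum_eq: "(\<Sum>p\<in>windows xs. ?c) = real (card (windows xs)) * ?c" by simp
  consider "?x < h - 1" | "?x = h - 1" | "h \<le> ?x" "windows xs = {}" | "h \<le> ?x" "windows xs \<noteq> {}"
    by linarith
  then show ?thesis
  proof cases
    case 1
    have "windows xs = {}"
    proof (rule ccontr)
      assume "windows xs \<noteq> {}"
      then obtain A B where "(A, B) \<in> windows xs" by (metis ex_in_conv surj_pair)
      then have "h - 1 = card {G \<in> core \<inter> prefix_sets xs. A \<subseteq> G \<and> G \<subseteq> B}"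
        by (simp add: windows_def)
      also have "\<dots> \<le> ?x" using finite_core by (intro card_mono) auto
      finally show False using 1 by simp
    qed
    then show ?thesis using 1 small by simp
  next
    case 2
    have "card (windows xs) \<le> 1"
      using windows_unique[OF 2] finite_windows[of xs] by (auto simp: card_le_Suc0_iff_eq)
    then have "real (card (windows xs)) * ?c \<ge> - 1 / 2" using 2 by simp
    moreover have "real ?x = real h - 1" using 2 h by simp
    ultimately show ?thesis using small unfolding sum_eq by linarith
  next
    \<comment> \<open>Without a window the chain has at most \<open>h\<close> members, hence exactly
      \<open>h\<close>, all in the core, and both sides vanish.\<close>
    case 3
    then have le: "card (\<F> \<inter> prefix_sets xs) \<le> h" using windows_nonempty[OF xs] by fastforce
    have "core \<inter> prefix_sets xs = \<F> \<inter> prefix_sets xs"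
      using le 3 core_subset finite_family by (intro card_seteq) auto
    then have "(\<F> - core) \<inter> prefix_sets xs = {}" by blast
    moreover have "?x = h"
      using le 3 card_mono[of "\<F> \<inter> prefix_sets xs" "core \<inter> prefix_sets xs"] core_subset finite_family
      by fastforce
    ultimately show ?thesis using 3 by simp
  next
    case 4
    then have "1 \<le> card (windows xs)"
      using finite_windows[of xs] by (simp add: Suc_le_eq card_gt_0_iff)
    moreover have hx: "real (h - 1) = real h - 1" "real h \<le> real ?x" using 4 h by auto
    then have "0 \<le> ?c" by simp
    ultimately have "1 * ?c \<le> real (card (windows xs)) * ?c" by (intro mult_right_mono) auto
    moreover have "real ?x + (\<Sum>G\<in>(\<F> - core) \<inter> prefix_sets xs. e G) - real h \<le> ?c"
      unfolding hx(1) using hx(2) small by argo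
    ultimately show ?thesis unfolding sum_eq mult_1 by (rule order_trans[rotated])
  qed
qed

text \<open>Summing \<open>chain_weight_le\<close> over all permutations gives the bound. The
  assumption \<open>far\<close> limits each far member to \<open>1 / (2 * (n + 1))\<close> on a
  chain, and a chain has only \<open>n + 1\<close> sets, which yields the \<open>1 / 2\<close>
  needed there.\<close>

lemma weighted_LYM:
  fixes l :: real
  assumes far: "\<And>j. j < r \<or> n < j + r \<Longrightarrow> 2 * (real n + 1) * (real (n choose j) * l) \<le> 1"
  shows "(\<Sum>G\<in>core. 1 / real (n choose card G)) + real (card (\<F> - core)) * l \<le> real h"
proof -
  \<comment> \<open>The factor is chosen to cancel the binomial in the double count, leaving weight
    \<open>l\<close> per far member.\<close>
  define e where "e G = real (n choose card G) * l" for G :: "nat set"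
  let ?Pi = "permutations_of_set {1..n}"
  have e_le: "e G \<le> 1 / (2 * (real n + 1))" if "G \<in> \<F> - core" for G
  proof -
    have "card G < r \<or> n < card G + r" using that by (auto simp: core_def)
    from far[OF this] show ?thesis by (simp add: e_def field_simps)
  qed
  have small: "(\<Sum>G\<in>(\<F> - core) \<inter> prefix_sets xs. e G) \<le> 1 / 2" if "xs \<in> ?Pi" for xs
  proof -
    have "length xs = n" using length_finite_permutations_of_set[OF that] by simp
    then have "prefix_sets xs \<subseteq> (\<lambda>k. set (take k xs)) ` {..n}"
      unfolding prefix_sets_def by (auto simp: image_iff) (metis atMost_iff linear take_all)
    then have "card (prefix_sets xs) \<le> n + 1" using surj_card_le[of "{..n}"] by fastforce
    moreover have "card ((\<F> - core) \<inter> prefix_sets xs) \<le> card (prefix_sets xs)"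
      by (intro card_mono finite_prefix_sets) auto
    ultimately have c: "real (card ((\<F> - core) \<inter> prefix_sets xs)) \<le> real n + 1" by linarith
    have "(\<Sum>G\<in>(\<F> - core) \<inter> prefix_sets xs. e G) \<le>
      real (card ((\<F> - core) \<inter> prefix_sets xs)) * (1 / (2 * (real n + 1)))"
      using e_le by (intro sum_bounded_above) auto
    also have "\<dots> \<le> (real n + 1) * (1 / (2 * (real n + 1)))"
      using c by (intro mult_right_mono) auto
    also have "\<dots> = 1 / 2" by (simp add: field_simps)
    finally show ?thesis .
  qed
  have "(\<Sum>xs\<in>?Pi. real (card (core \<inter> prefix_sets xs)) + (\<Sum>G\<in>(\<F> - core) \<inter> prefix_sets xs. e G) - real h)
    \<le> (\<Sum>xs\<in>?Pi. \<Sum>p\<in>windows xs. 2 * (real (card (core \<inter> prefix_sets xs)) - real (h - 1)) - 1 / 2)"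
    using small by (intro sum_mono chain_weight_le)
  also have "\<dots> \<le> 0" by (rule sum_windows_le_0)
  finally have "(\<Sum>xs\<in>?Pi. real (card (core \<inter> prefix_sets xs)))
    + (\<Sum>xs\<in>?Pi. \<Sum>G\<in>(\<F> - core) \<inter> prefix_sets xs. e G) \<le> fact n * real h"
    by (simp add: sum.distrib sum_subtractf)
  moreover have "(\<Sum>xs\<in>?Pi. real (card (core \<inter> prefix_sets xs))) =
      fact n * (\<Sum>G\<in>core. 1 / real (n choose card G))"
    using sum_sum_permutations_through[of "{1..n}" core "\<lambda>_. 1"] core_Pow by (auto simp: subset_iff)
  moreover have "(\<Sum>xs\<in>?Pi. \<Sum>G\<in>(\<F> - core) \<inter> prefix_sets xs. e G) =
      fact n * (\<Sum>G\<in>\<F> - core. e G / real (n choose card G))"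
    using sum_sum_permutations_through[of "{1..n}" "\<F> - core" e] family by auto
  moreover have "(\<Sum>G\<in>\<F> - core. e G / real (n choose card G)) = real (card (\<F> - core)) * l"
  proof -
    have "e G / real (n choose card G) = l" if "G \<in> \<F> - core" for G
    proof -
      have "card G \<le> n" using that family card_mono[of "{1..n}" G] by auto
      then show ?thesis by (simp add: e_def)
    qed
    then show ?thesis by simp
  qed
  ultimately have "fact n * ((\<Sum>G\<in>core. 1 / real (n choose card G)) + real (card (\<F> - core)) * l)
      \<le> fact n * real h"
    by (simp add: distrib_left)
  then show ?thesis by (simp add: mult_le_cancel_left_pos)
qed

end

section \<open>Comparison with the middle layers\<close>

lemma binomial_Suc_mult: "Suc k * (n choose Suc k) = (n - k) * (n choose k)"
  using binomial_absorption[of k n] binomial_absorb_comp[of n k] by simp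

text \<open>A far level has at most \<open>n choose (r - 1)\<close> sets. Going up two levels to
  \<open>r + 1\<close>, still no larger than level \<open>q\<close>, gains a factor quadratic in
  \<open>n\<close>, which beats \<open>2 * (n + 1)\<close> for large \<open>n\<close>; one level
  would gain only about \<open>n / r\<close>.\<close>

lemma binomial_far_le:
  fixes n h r q j :: nat
  assumes r: "1 \<le> r" and n: "8 * (r * (r + 1)) + h + 3 \<le> n" and q: "q = (n - h + 1) div 2"
    and j: "j < r \<or> n < j + r"
  shows "2 * (n + 1) * (n choose j) \<le> n choose q"
proof -
  have rr: "r \<le> r * r" using r by simp
  have big: "2 * r + 2 + h \<le> n" "2 * r + 3 \<le> n"
    using n rr unfolding distrib_left by linarith+
  have "n choose j \<le> n choose (r - 1)"
  proof (cases "j < r")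
    case True
    then show ?thesis using big by (intro binomial_le_of_le) auto
  next
    case False
    show ?thesis
    proof (cases "j \<le> n")
      case True
      have "n choose (n - j) \<le> n choose (r - 1)"
        using False j True big by (intro binomial_le_of_le) auto
      then show ?thesis using binomial_symmetric[OF True] by simp
    qed (simp add: binomial_eq_0)
  qed
  moreover have "n choose (r + 1) \<le> n choose q"
    using big unfolding q by (intro binomial_le_of_le) auto
  moreover have "2 * (n + 1) * (n choose (r - 1)) \<le> n choose (r + 1)"
  proof -
    have "(r * (r + 1)) * (n choose (r + 1)) = r * ((n - r) * (n choose r))"
      by (metis Suc_eq_plus1 mult.assoc binomial_Suc_mult)
    also have "\<dots> = (n - r) * ((n - (r - 1)) * (n choose (r - 1)))"
      using binomial_Suc_mult[of "r - 1" n] r by (simp add: mult.left_commute)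
    finally have eq: "(r * (r + 1)) * (n choose (r + 1)) = ((n - r) * (n - (r - 1))) * (n choose (r - 1))"
      by (simp only: mult.assoc)
    \<comment> \<open>The product of these two bounds, halved, is the required comparison of
      \<open>2 * (n + 1)\<close> with the two-level ratio.\<close>
    have "4 * (r * (r + 1)) \<le> n - r" "n + 1 \<le> 2 * (n - (r - 1))"
      using n big rr by auto
    then have "(4 * (r * (r + 1))) * (n + 1) \<le> (n - r) * (2 * (n - (r - 1)))"
      by (rule mult_le_mono)
    moreover have "R * (2 * m) \<le> a * N" if "(4 * R) * m \<le> a * (2 * N)" for R m a N :: nat
      using that by (simp add: algebra_simps)
    ultimately have "(r * (r + 1)) * (2 * (n + 1)) \<le> (n - r) * (n - (r - 1))" by blast
    then have "(r * (r + 1)) * (2 * (n + 1)) * (n choose (r - 1)) \<le> (r * (r + 1)) * (n choose (r + 1))"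
      unfolding eq by (rule mult_le_mono1)
    then have "(r * (r + 1)) * (2 * (n + 1) * (n choose (r - 1))) \<le> (r * (r + 1)) * (n choose (r + 1))"
      by (simp only: mult.assoc)
    moreover have "0 < r * (r + 1)" using r by simp
    ultimately show ?thesis by (metis mult_le_cancel1)
  qed
  ultimately show ?thesis by (meson le_trans mult_le_mono2)
qed

text \<open>An exchange argument: members outside the middle layers weigh at least \<open>l\<close>,
  missing middle sets weigh at most \<open>l\<close>, and the total weight of the family is at most
  \<open>h\<close>, the weight of all middle layers. So at least as many middle sets are missing as
  there are members outside.\<close>

lemma card_Y_free_le:
  fixes n h s r :: nat
  assumes family: "\<F> \<subseteq> Pow {1..n}" and free: "rp_free {Y_poset h s, Y_poset_dual h s} \<F>"
    and h: "2 \<le> h" and r: "r = 32 * s + 4" and large: "8 * (r * (r + 1)) + h + 3 \<le> n"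
  shows "card \<F> \<le> Sigma_layers n h"
proof -
  \<comment> \<open>Level \<open>q\<close> is as large as the smallest of the \<open>h\<close> middle layers.\<close>
  define q where "q = (n - h + 1) div 2"
  define l where "l = 1 / real (n choose q)"
  define v where "v G = 1 / real (n choose card G)" for G :: "nat set"
  let ?M = "middle_layers n h"
  have hn: "h \<le> n" "2 * r \<le> n" using large by auto
  have "q \<le> n" using hn by (auto simp: q_def)
  then have pos: "0 < real (n choose q)" by simp
  interpret Y_free_family n h s r \<F>
    using family free h r hn by unfold_locales auto
  have finM: "finite ?M"
    by (rule finite_subset[of _ "Pow {1..n}"]) (auto simp: middle_layers_def)
  have in_M: "v G \<le> l" if "G \<in> ?M" for G
  proof -
    have "card G \<le> n" using that card_mono[of "{1..n}" G] by (auto simp: middle_layers_def)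
    then have "n choose q \<le> n choose card G"
      using that by (intro binomial_le_of_le) (auto simp: middle_layers_def q_def)
    then show ?thesis unfolding v_def l_def using pos by (intro frac_le) auto
  qed
  have out_M: "l \<le> v G" if "G \<in> \<F> - ?M" for G
  proof -
    have sub: "G \<subseteq> {1..n}" using that family by auto
    then have le: "card G \<le> n" using card_mono[of "{1..n}" G] by auto
    have "\<not> (n < 2 * card G + h \<and> 2 * card G \<le> n + h)"
      using that sub by (auto simp: middle_layers_def)
    then consider "card G \<le> q" | "n - card G \<le> q" unfolding q_def by linarith
    then have "n choose card G \<le> n choose q"
    proof cases
      case 1
      then show ?thesis using h by (intro binomial_le_of_le) (auto simp: q_def)
    next
      case 2
      then have "n choose (n - card G) \<le> n choose q"
        using h by (intro binomial_le_of_le) (auto simp: q_def)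
      then show ?thesis using binomial_symmetric[OF le] by simp
    qed
    moreover have "0 < n choose card G" using le by simp
    ultimately show ?thesis unfolding v_def l_def by (intro frac_le) auto
  qed
  have far: "2 * (real n + 1) * (real (n choose j) * l) \<le> 1" if "j < r \<or> n < j + r" for j
  proof -
    have "real (2 * (n + 1) * (n choose j)) \<le> real (n choose q)"
      using binomial_far_le[OF _ large q_def that] r by (intro of_nat_mono) simp
    then show ?thesis using pos by (simp add: l_def field_simps)
  qed
  \<comment> \<open>The weight bounded by \<open>weighted_LYM\<close>: the LYM weight on the core
    and the flat weight \<open>l\<close> on far members.\<close>
  define w where "w G = (if G \<in> core then v G else l)" for G
  have w_ge: "(if G \<in> ?M then v G else l) \<le> w G" if "G \<in> \<F>" for G
    using in_M[of G] out_M[of G] that by (auto simp: w_def)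
  have "(\<Sum>G\<in>\<F> \<inter> ?M. v G) + real (card (\<F> - ?M)) * l = (\<Sum>G\<in>\<F>. if G \<in> ?M then v G else l)"
    using finite_family by (simp add: sum.If_cases Diff_eq)
  also have "\<dots> \<le> (\<Sum>G\<in>\<F>. w G)" using w_ge by (rule sum_mono)
  also have "\<dots> = (\<Sum>G\<in>core. v G) + real (card (\<F> - core)) * l"
    using finite_family core_subset
    by (simp add: w_def sum.If_cases Diff_eq Int_absorb1)
  also have "\<dots> \<le> real h"
    unfolding v_def using far by (rule weighted_LYM)
  also have "\<dots> = (\<Sum>G\<in>?M. v G)"
    using sum_inverse_binomial_middle_layers[OF hn(1)] by (simp add: v_def)
  also have "\<dots> = (\<Sum>G\<in>\<F> \<inter> ?M. v G) + (\<Sum>G\<in>?M - \<F>. v G)"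
    using finM by (subst sum.Int_Diff[of _ _ \<F>]) (auto simp: Int_commute)
  also have "\<dots> \<le> (\<Sum>G\<in>\<F> \<inter> ?M. v G) + real (card (?M - \<F>)) * l"
    using in_M by (intro add_left_mono sum_bounded_above) auto
  finally have "real (card (\<F> - ?M)) \<le> real (card (?M - \<F>))"
    using pos by (simp add: l_def divide_right_mono field_simps)
  then have "card (\<F> - ?M) + card (\<F> \<inter> ?M) \<le> card (?M - \<F>) + card (?M \<inter> \<F>)"
    by (simp add: Int_commute)
  then show ?thesis
    using finM finite_family
    by (simp add: Sigma_layers_def card_Int_Diff[of \<F> ?M] card_Int_Diff[of ?M \<F>])
qed

theorem theorem1p4:
  fixes s h :: nat
  assumes "s \<ge> 2" and "h \<ge> 2"
  shows "\<exists>n\<^sub>0. \<forall>n\<ge>n\<^sub>0.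
    La_rp n {Y_poset h s, Y_poset_dual h s} = Sigma_layers n h \<and>
    Sigma_layers n h = (\<Sum>i=1..h. n choose ((n - h) div 2 + i))"
proof -
  \<comment> \<open>The least value that \<open>sum_card_sparse_le\<close> permits; the threshold
    for \<open>n\<close> below is the one from \<open>binomial_far_le\<close>.\<close>
  define r where "r = 32 * s + 4"
  have "La_rp n {Y_poset h s, Y_poset_dual h s} = Sigma_layers n h \<and>
    Sigma_layers n h = (\<Sum>i=1..h. n choose ((n - h) div 2 + i))"
    if n: "8 * (r * (r + 1)) + h + 3 \<le> n" for n
  proof
    have hn: "h \<le> n" using n by simp
    let ?\<P> = "{Y_poset h s, Y_poset_dual h s}"
    have "rp_free ?\<P> (middle_layers n h)"
      unfolding rp_free_def using middle_layers_no_copy[OF hn] assms by fastforce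
    moreover have "middle_layers n h \<subseteq> Pow {1..n}" by (auto simp: middle_layers_def)
    ultimately have attained:
      "Sigma_layers n h \<in> {card \<F> |\<F>. \<F> \<subseteq> Pow {1..n} \<and> rp_free ?\<P> \<F>}"
      unfolding Sigma_layers_def by blast
    show "La_rp n ?\<P> = Sigma_layers n h"
      unfolding La_rp_def
    proof (rule Max_eqI[OF _ _ attained])
      show "finite {card \<F> |\<F>. \<F> \<subseteq> Pow {1..n} \<and> rp_free ?\<P> \<F>}"
        by (rule finite_subset[of _ "card ` Pow (Pow {1..n})"]) auto
    qed (use card_Y_free_le[OF _ _ assms(2) r_def n] in blast)
    show "Sigma_layers n h = (\<Sum>i=1..h. n choose ((n - h) div 2 + i))"
      by (rule Sigma_layers_eq_sum[OF hn])
  qed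
  then show ?thesis by blast
qed

end
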